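(* Let $A \in \mathbb{R}^{n \times n}$ be a nonzero matrix of rank $r$ with $\mathcal{N}(A) \cap \mathcal{R}(A) = \{\boldsymbol{0}\}$. Let $\boldsymbol{b} \in \mathcal{R}(A)$, $\boldsymbol{x}_0 \in \mathbb{R}^n$, $\boldsymbol{r}_0 = \boldsymbol{b} - A\boldsymbol{x}_0$, and let $k \geq 1$ be such that $\dim \mathcal{K}_k(A,\boldsymbol{r}_0) = k$. Then the extended Hessenberg matrix $H_{k+1,k}$ of GMRES satisfies $$\sigma_1(H_{k+1,k}) \leq \|A\| \, \|V_1^{\mathsf{T}} U_1\|, \qquad \sigma_k(H_{k+1,k}) \geq \sigma_r(A)\, \sigma_r(V_1^{\mathsf{T}} U_1),$$ and consequently $\kappa(H_{k+1,k}) \leq \kappa(A)\, \kappa(V_1^{\mathsf{T}} U_1)$.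
   Context: $\mathcal{R}(\cdot)$ and $\mathcal{N}(\cdot)$ denote range and nullspace, $\|\cdot\|$ is the Euclidean vector norm and the induced (spectral) matrix norm, $\sigma_i(\cdot)$ is the $i$th largest singular value, and $\kappa(M) = \|M\|\,\|M^\dagger\|$ with $M^\dagger$ the Moore-Penrose pseudoinverse (so $\kappa(M)$ is the ratio of the largest to the smallest nonzero singular value). The columns of $U_1 \in \mathbb{R}^{n\times r}$ and $V_1 \in \mathbb{R}^{n \times r}$ are the left and right singular vectors in the singular value decomposition $A = U_1 \Sigma_r V_1^{\mathsf{T}}$, $\Sigma_r = \mathrm{diag}(\sigma_1(A),\dots,\sigma_r(A))$ with $\sigma_r(A)>0$; they form orthonormal bases of $\mathcal{R}(A)$ and $\mathcal{R}(A^{\mathsf{T}})$, respectively. $\mathcal{K}_k(A,\boldsymbol{r}_0) = \mathrm{span}\{\boldsymbol{r}_0, A\boldsymbol{r}_0, \dots, A^{k-1}\boldsymbol{r}_0\}$ is the Krylov subspace. The extended Hessenberg matrix $H_{k+1,k} \in \mathbb{R}^{(k+1)\times k}$ comes from the Arnoldi decomposition $A Q_k = Q_{k+1} H_{k+1,k}$, where $Q_k = [\boldsymbol{q}_1,\dots,\boldsymbol{q}_k]$ has orthonormal columns with $\boldsymbol{q}_1 = \boldsymbol{r}_0/\|\boldsymbol{r}_0\|$ and $\mathrm{span}\{\boldsymbol{q}_1,\dots,\boldsymbol{q}_i\} = \mathcal{K}_i(A,\boldsymbol{r}_0)$ for $i\le k$, and $Q_{k+1} = [Q_k,\boldsymbol{q}_{k+1}]$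 where $\boldsymbol{q}_{k+1}$ extends this to an orthonormal basis of $\mathcal{K}_{k+1}(A,\boldsymbol{r}_0)$ if $\dim \mathcal{K}_{k+1}(A,\boldsymbol{r}_0) = k+1$; if $\dim \mathcal{K}_{k+1}(A,\boldsymbol{r}_0) = k$, the last row of $H_{k+1,k}$ is zero and $A Q_k = Q_k H_{k,k}$ with $H_{k,k}$ the first $k$ rows. In particular $\|A Q_k \boldsymbol{w}\| = \|H_{k+1,k}\boldsymbol{w}\|$ for all $\boldsymbol{w}\in\mathbb{R}^k$. *)

theory Defs
  imports
    "HOL-Computational_Algebra.Polynomial"
    "Jordan_Normal_Form.Char_Poly"
    "Jordan_Normal_Form.Matrix_Kernel"
    "Jordan_Normal_Form.DL_Rank"
begin

section \<open>Norms, singular values and condition numbers of real matrices\<close>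

definition eucl_norm :: "real vec \<Rightarrow> real" where
  "eucl_norm v = sqrt (v \<bullet> v)"

text \<open>The supremum runs over the closed unit ball rather than the unit sphere, so that it is
  also taken over a nonempty set when the matrix has no columns.\<close>

definition spectral_norm :: "real mat \<Rightarrow> real" where
  "spectral_norm M =
     (SUP v \<in> {v \<in> carrier_vec (dim_col M). eucl_norm v \<le> 1}. eucl_norm (M *\<^sub>v v))"

text \<open>\<open>sing_val i M\<close> is the \<open>i\<close>th largest singular value, counted from \<open>i = 1\<close> and with
  multiplicity. If \<open>M\<close> has more columns than rows, the list also contains the surplus zero
  eigenvalues of \<open>M\<^sup>T M\<close>, at its end.\<close>

definition sing_val :: "nat \<Rightarrow> real mat \<Rightarrow> real" where
  "sing_val i M =
     rev (sorted_list_of_multiset (image_mset sqrt (proots (char_poly (M\<^sup>T * M))))) ! (i - 1)"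

definition is_pinv :: "real mat \<Rightarrow> real mat \<Rightarrow> bool" where
  "is_pinv M X \<longleftrightarrow>
     X \<in> carrier_mat (dim_col M) (dim_row M) \<and>
     M * X * M = M \<and> X * M * X = X \<and>
     (M * X)\<^sup>T = M * X \<and> (X * M)\<^sup>T = X * M"

definition pinv :: "real mat \<Rightarrow> real mat" where
  "pinv M = (THE X. is_pinv M X)"

definition cond_num :: "real mat \<Rightarrow> real" where
  "cond_num M = spectral_norm M * spectral_norm (pinv M)"

definition orthonormal_cols :: "real mat \<Rightarrow> bool" where
  "orthonormal_cols M \<longleftrightarrow> M\<^sup>T * M = 1\<^sub>m (dim_col M)"

text \<open>The compact singular value decomposition of an \<open>n \<times> n\<close> matrix of rank \<open>r\<close>; only the
  \<open>r\<close> leading singular vectors are kept.\<close>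

definition is_compact_svd :: "nat \<Rightarrow> nat \<Rightarrow> real mat \<Rightarrow> real mat \<Rightarrow> real mat \<Rightarrow> bool" where
  "is_compact_svd n r A U V \<longleftrightarrow>
     U \<in> carrier_mat n r \<and> V \<in> carrier_mat n r \<and>
     orthonormal_cols U \<and> orthonormal_cols V \<and>
     A = U * mat_diag r (\<lambda>i. sing_val (i + 1) A) * V\<^sup>T \<and>
     sing_val r A > 0"

section \<open>Krylov subspaces and the Arnoldi decomposition\<close>

definition lin_span :: "nat \<Rightarrow> real vec set \<Rightarrow> real vec set" where
  "lin_span n S = LinearCombinations.module.span class_ring (module_vec TYPE(real) n) S"

definition subspace_dim :: "nat \<Rightarrow> real vec set \<Rightarrow> nat" where
  "subspace_dim n W =
     vectorspace.dim class_ring ((module_vec TYPE(real) n)\<lparr>carrier := W\<rparr>)"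

definition krylov :: "nat \<Rightarrow> real mat \<Rightarrow> real vec \<Rightarrow> nat \<Rightarrow> real vec set" where
  "krylov n A v k = lin_span n ((\<lambda>j. (A ^\<^sub>m j) *\<^sub>v v) ` {..<k})"

text \<open>\<open>arnoldi n A v k Q H\<close>: the \<open>n \<times> k\<close> matrix \<open>Q\<close> and the extended Hessenberg matrix
  \<open>H\<close> result from \<open>k\<close> steps of the Arnoldi process started at \<open>v\<close>. The second disjunct is
  the breakdown case, in which no further basis vector exists.\<close>

definition arnoldi :: "nat \<Rightarrow> real mat \<Rightarrow> real vec \<Rightarrow> nat \<Rightarrow> real mat \<Rightarrow> real mat \<Rightarrow> bool" where
  "arnoldi n A v k Q H \<longleftrightarrow>
     Q \<in> carrier_mat n k \<and> H \<in> carrier_mat (k + 1) k \<and>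
     orthonormal_cols Q \<and>
     col Q 0 = (1 / eucl_norm v) \<cdot>\<^sub>v v \<and>
     (\<forall>i \<le> k. lin_span n (col Q ` {..<i}) = krylov n A v i) \<and>
     ((subspace_dim n (krylov n A v (k + 1)) = k + 1 \<and>
        (\<exists>q \<in> carrier_vec n. let Q' = mat_of_cols n (cols Q @ [q]) in
           orthonormal_cols Q' \<and>
           lin_span n (set (cols Q')) = krylov n A v (k + 1) \<and>
           A * Q = Q' * H)) \<or>
      (subspace_dim n (krylov n A v (k + 1)) = k \<and>
        row H k = 0\<^sub>v k \<and>
        A * Q = Q * mat k k (\<lambda>(i, j). H $$ (i, j))))"

end

theory Submission
  imports Defs
begin

text \<open>Since \<open>r\<^sub>0 \<in> \<R>(A)\<close>, the Krylov space lies in the range of \<open>A\<close>, so every \<open>Q w\<close> equals \<open>U\<^sub>1 y\<close>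
  with \<open>\<parallel>y\<parallel> = \<parallel>w\<parallel>\<close>. Then \<open>\<parallel>H w\<parallel> = \<parallel>A Q w\<parallel>\<close> is the norm of \<open>A V\<^sub>1 (P y) = U\<^sub>1 \<Sigma> (P y)\<close>, where
  \<open>P = V\<^sub>1\<^sup>T U\<^sub>1\<close>, and this lies between \<open>\<sigma>\<^sub>r(A) \<sigma>\<^sub>r(P) \<parallel>w\<parallel>\<close> and \<open>\<parallel>A\<parallel> \<parallel>P\<parallel> \<parallel>w\<parallel>\<close>. The extreme singular values
  are the extreme stretching factors, by the Rayleigh quotient. The hypothesis on
  \<open>\<N>(A) \<inter> \<R>(A)\<close> makes \<open>P\<close> injective, so that the reciprocals of the lower bounds exist and are
  the norms of the pseudoinverses.\<close>

section \<open>Rayleigh quotients of symmetric matrices\<close>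

lemma scalar_prod_self_nonneg: "0 \<le> (v :: real vec) \<bullet> v"
  using conjugate_square_ge_0_vec[of v] by simp

lemma scalar_prod_self_eq_0: "v \<in> carrier_vec n \<Longrightarrow> (v :: real vec) \<bullet> v = 0 \<longleftrightarrow> v = 0\<^sub>v n"
  using conjugate_square_eq_0_vec[of v n] by simp

lemma eucl_norm_nonneg [simp]: "0 \<le> eucl_norm v"
  by (simp add: eucl_norm_def scalar_prod_self_nonneg)

lemma eucl_norm_square: "(eucl_norm v)\<^sup>2 = v \<bullet> v"
  by (simp add: eucl_norm_def scalar_prod_self_nonneg)

lemma eucl_norm_eq_0: "v \<in> carrier_vec n \<Longrightarrow> eucl_norm v = 0 \<longleftrightarrow> v = 0\<^sub>v n"
  by (simp add: eucl_norm_def scalar_prod_self_eq_0)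

lemma eucl_norm_smult: "eucl_norm (c \<cdot>\<^sub>v v) = \<bar>c\<bar> * eucl_norm v"
  by (simp add: eucl_norm_def real_sqrt_mult flip: mult.assoc)

text \<open>Each entry of the image is at most an absolute row sum times the norm of
  \<open>v\<close>. The constant is crude: only its existence matters, for bounding Rayleigh
  quotients and the set in \<open>spectral_norm\<close>. The summand 1 keeps it positive for the
  zero matrix, so that it may be divided by.\<close>

lemma mult_mat_vec_bounded:
  fixes M :: "real mat"
  assumes M: "M \<in> carrier_mat m n"
  obtains C where "C > 0" and "\<And>v. v \<in> carrier_vec n \<Longrightarrow> (M *\<^sub>v v) \<bullet> (M *\<^sub>v v) \<le> C * (v \<bullet> v)"
proof
  define c where "c i = (\<Sum>j<n. \<bar>M $$ (i, j)\<bar>)" for i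
  show "(\<Sum>i<m. (c i)\<^sup>2) + 1 > 0"
    by (simp add: add_nonneg_pos sum_nonneg)
  fix v :: "real vec" assume v: "v \<in> carrier_vec n"
  have entry: "\<bar>v $ j\<bar> \<le> eucl_norm v" if "j < n" for j
  proof -
    have "(v $ j)\<^sup>2 \<le> (\<Sum>i<n. (v $ i)\<^sup>2)"
      using that by (intro member_le_sum) auto
    also have "\<dots> = v \<bullet> v"
      using v by (simp add: scalar_prod_def power2_eq_square lessThan_atLeast0)
    finally show ?thesis
      by (simp add: eucl_norm_def real_le_rsqrt)
  qed
  have row: "\<bar>(M *\<^sub>v v) $ i\<bar> \<le> c i * eucl_norm v" if "i < m" for i
  proof -
    have "\<bar>(M *\<^sub>v v) $ i\<bar> = \<bar>\<Sum>j<n. M $$ (i, j) * v $ j\<bar>"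
      using M v that by (simp add: scalar_prod_def lessThan_atLeast0)
    also have "\<dots> \<le> (\<Sum>j<n. \<bar>M $$ (i, j) * v $ j\<bar>)"
      by (rule sum_abs)
    also have "\<dots> \<le> (\<Sum>j<n. \<bar>M $$ (i, j)\<bar> * eucl_norm v)"
      by (intro sum_mono) (simp add: abs_mult entry mult_left_mono)
    finally show ?thesis
      by (simp add: c_def sum_distrib_right)
  qed
  have "(M *\<^sub>v v) \<bullet> (M *\<^sub>v v) = (\<Sum>i<m. ((M *\<^sub>v v) $ i)\<^sup>2)"
    using M by (simp add: scalar_prod_def power2_eq_square lessThan_atLeast0)
  also have "\<dots> \<le> (\<Sum>i<m. (c i * eucl_norm v)\<^sup>2)"
    using row by (intro sum_mono) (metis abs_ge_zero lessThan_iff power2_abs power_mono)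
  also have "\<dots> = (\<Sum>i<m. (c i)\<^sup>2) * (v \<bullet> v)"
    by (simp add: power_mult_distrib eucl_norm_square sum_distrib_right)
  also have "\<dots> \<le> ((\<Sum>i<m. (c i)\<^sup>2) + 1) * (v \<bullet> v)"
    by (intro mult_right_mono) (auto simp: scalar_prod_self_nonneg)
  finally show "(M *\<^sub>v v) \<bullet> (M *\<^sub>v v) \<le> ((\<Sum>i<m. (c i)\<^sup>2) + 1) * (v \<bullet> v)" .
qed

text \<open>Expand the square of \<open>v - w\<close>. This weak form of Cauchy-Schwarz, free of
  square roots, bounds quadratic forms and shows that orthogonal projections do not increase the
  norm.\<close>

lemma scalar_prod_le_mean:
  fixes v w :: "real vec"
  assumes "v \<in> carrier_vec n" "w \<in> carrier_vec n"
  shows "v \<bullet> w \<le> (v \<bullet> v + w \<bullet> w) / 2"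
proof -
  have "0 \<le> (v - w) \<bullet> (v - w)"
    by (rule scalar_prod_self_nonneg)
  also have "\<dots> = v \<bullet> v - 2 * (v \<bullet> w) + w \<bullet> w"
    using assms by (simp add: minus_scalar_prod_distrib[of _ n] scalar_prod_minus_distrib[of _ n]
      comm_scalar_prod[of w n v])
  finally show ?thesis by simp
qed

section \<open>Extremal Rayleigh quotients\<close>

lemma symmetric_mat_scalar_prod:
  fixes S :: "real mat"
  assumes "S \<in> carrier_mat n n" "S\<^sup>T = S" "v \<in> carrier_vec n" "w \<in> carrier_vec n"
  shows "v \<bullet> (S *\<^sub>v w) = (S *\<^sub>v v) \<bullet> w"
  using transpose_vec_mult_scalar[of S n n w v] assms by simp

text \<open>If \<open>C\<close> bounds the form on unit vectors, its nonnegativity at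
  \<open>v - (1 / C) \<cdot>\<^sub>v (T *\<^sub>v v)\<close> yields the inequality with the same
  \<open>C\<close>. Thus a vector on which the form is small is nearly annihilated by
  \<open>T\<close>.\<close>

lemma psd_mult_vec_le:
  fixes T :: "real mat"
  assumes T: "T \<in> carrier_mat n n" "T\<^sup>T = T"
    and psd: "\<And>v. v \<in> carrier_vec n \<Longrightarrow> 0 \<le> v \<bullet> (T *\<^sub>v v)"
  obtains C where "C > 0"
    and "\<And>v. v \<in> carrier_vec n \<Longrightarrow> (T *\<^sub>v v) \<bullet> (T *\<^sub>v v) \<le> C * (v \<bullet> (T *\<^sub>v v))"
proof -
  obtain B where B: "B > 0"
    "\<And>v. v \<in> carrier_vec n \<Longrightarrow> (T *\<^sub>v v) \<bullet> (T *\<^sub>v v) \<le> B * (v \<bullet> v)"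
    using mult_mat_vec_bounded[OF T(1)] by blast
  define C where "C = (1 + B) / 2"
  have C: "C > 0" using B(1) by (simp add: C_def)
  have form_le: "v \<bullet> (T *\<^sub>v v) \<le> C * (v \<bullet> v)" if v: "v \<in> carrier_vec n" for v
    using scalar_prod_le_mean[of v n "T *\<^sub>v v"] B(2)[OF v] v T(1)
    by (simp add: C_def field_simps)
  show thesis
  proof (rule that[OF C])
    fix v :: "real vec" assume v: "v \<in> carrier_vec n"
    define w where "w = T *\<^sub>v v"
    have w: "w \<in> carrier_vec n" using T v by (simp add: w_def)
    have Tw: "T *\<^sub>v w \<in> carrier_vec n" using T w by simp
    have "0 \<le> (v - (1 / C) \<cdot>\<^sub>v w) \<bullet> (T *\<^sub>v (v - (1 / C) \<cdot>\<^sub>v w))"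
      using v w by (intro psd) simp
    also have "T *\<^sub>v (v - (1 / C) \<cdot>\<^sub>v w) = w - (1 / C) \<cdot>\<^sub>v (T *\<^sub>v w)"
      using v w T(1) by (simp add: mult_minus_distrib_mat_vec[of _ n n] mult_mat_vec[of _ n n] w_def)
    also have "(v - (1 / C) \<cdot>\<^sub>v w) \<bullet> (w - (1 / C) \<cdot>\<^sub>v (T *\<^sub>v w))
        = v \<bullet> w - (1 / C) * (v \<bullet> (T *\<^sub>v w)) - (1 / C) * (w \<bullet> w)
          + (1 / C) * ((1 / C) * (w \<bullet> (T *\<^sub>v w)))"
      using v w Tw
      by (simp add: minus_scalar_prod_distrib[of _ n] scalar_prod_minus_distrib[of _ n])
    also have "v \<bullet> (T *\<^sub>v w) = w \<bullet> w"
      using symmetric_mat_scalar_prod[OF T v w] by (simp add: w_def)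
    finally have "0 \<le> v \<bullet> w - 2 / C * (w \<bullet> w) + (1 / C) * ((1 / C) * (w \<bullet> (T *\<^sub>v w)))"
      by simp
    also have "\<dots> \<le> v \<bullet> w - 2 / C * (w \<bullet> w) + (1 / C) * ((1 / C) * (C * (w \<bullet> w)))"
      using form_le[OF w] C by (intro add_left_mono mult_left_mono) auto
    also have "\<dots> = v \<bullet> w - (w \<bullet> w) / C"
      using C by (simp add: field_simps)
    finally show "(T *\<^sub>v v) \<bullet> (T *\<^sub>v v) \<le> C * (v \<bullet> (T *\<^sub>v v))"
      using C by (simp add: w_def field_simps)
  qed
qed

text \<open>The least upper bound \<open>\<mu>\<close> of the Rayleigh quotient is an eigenvalue, without any
  compactness argument: otherwise \<open>T = \<mu>I - S\<close> is positive semidefinite with a bounded inverse,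
  so that \<open>v \<bullet> T v\<close> dominates \<open>\<bar>T v\<bar>\<^sup>2\<close> and hence \<open>\<bar>v\<bar>\<^sup>2\<close>, and \<open>\<mu>\<close> could be lowered.\<close>

lemma symmetric_rayleigh_max:
  fixes S :: "real mat"
  assumes S: "S \<in> carrier_mat n n" "S\<^sup>T = S" and n: "n > 0"
  obtains \<mu> where "eigenvalue S \<mu>"
    and "\<And>v. v \<in> carrier_vec n \<Longrightarrow> v \<bullet> (S *\<^sub>v v) \<le> \<mu> * (v \<bullet> v)"
proof -
  define W where "W = {m. \<forall>v\<in>carrier_vec n. v \<bullet> (S *\<^sub>v v) \<le> m * (v \<bullet> v)}"
  define \<mu> where "\<mu> = Inf W"
  obtain C where C: "C > 0"
    "\<And>v. v \<in> carrier_vec n \<Longrightarrow> (S *\<^sub>v v) \<bullet> (S *\<^sub>v v) \<le> C * (v \<bullet> v)"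
    using mult_mat_vec_bounded[OF S(1)] by blast
  have "v \<bullet> (S *\<^sub>v v) \<le> (1 + C) / 2 * (v \<bullet> v)" if v: "v \<in> carrier_vec n" for v
    using scalar_prod_le_mean[of v n "S *\<^sub>v v"] C(2)[OF v] v S(1)
    by (simp add: field_simps)
  then have "(1 + C) / 2 \<in> W" unfolding W_def by blast
  then have W_ne: "W \<noteq> {}" by blast
  \<comment> \<open>A unit vector, available because \<open>n > 0\<close>, bounds \<open>W\<close>
    from below: every \<open>m\<close> in \<open>W\<close> is at least
    \<open>e \<bullet> (S *\<^sub>v e)\<close>.\<close>
  define e :: "real vec" where "e = unit_vec n 0"
  have e: "e \<in> carrier_vec n" "e \<bullet> e = 1" using n by (auto simp: e_def)
  have W_bdd: "bdd_below W"
    by (rule bdd_belowI[of _ "e \<bullet> (S *\<^sub>v e)"]) (use e in \<open>force simp: W_def\<close>)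
  \<comment> \<open>The infimum itself belongs to \<open>W\<close>, since each Rayleigh quotient is
    a lower bound of \<open>W\<close>.\<close>
  have ray: "v \<bullet> (S *\<^sub>v v) \<le> \<mu> * (v \<bullet> v)" if v: "v \<in> carrier_vec n" for v
  proof (cases "v \<bullet> v = 0")
    case True
    then have "v = 0\<^sub>v n" using scalar_prod_self_eq_0[OF v] by simp
    then show ?thesis using S(1) by simp
  next
    case False
    then have pos: "v \<bullet> v > 0" using scalar_prod_self_nonneg[of v] by simp
    have "v \<bullet> (S *\<^sub>v v) / (v \<bullet> v) \<le> \<mu>"
      unfolding \<mu>_def
      by (rule cInf_greatest[OF W_ne]) (use v pos in \<open>auto simp: W_def field_simps\<close>)
    then show ?thesis using pos by (simp add: field_simps)
  qed
  define T where "T = \<mu> \<cdot>\<^sub>m 1\<^sub>m n - S"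
  have T: "T \<in> carrier_mat n n" using S(1) unfolding T_def by (rule minus_carrier_mat)
  have T_sym: "T\<^sup>T = T"
  proof (rule eq_matI)
    fix i j assume "i < dim_row T" "j < dim_col T"
    moreover from this have "S $$ (j, i) = S $$ (i, j)"
      using S T by (metis carrier_matD index_transpose_mat(1))
    ultimately show "T\<^sup>T $$ (i, j) = T $$ (i, j)"
      using T S(1) by (auto simp: T_def)
  qed (use T in auto)
  have Tv: "T *\<^sub>v v = \<mu> \<cdot>\<^sub>v v - S *\<^sub>v v" if v: "v \<in> carrier_vec n" for v
  proof -
    have "(\<mu> \<cdot>\<^sub>m 1\<^sub>m n) *\<^sub>v v = \<mu> \<cdot>\<^sub>v v"
      using v by (intro eq_vecI) auto
    then show ?thesis
      using v S(1) by (simp add: T_def minus_mult_distrib_mat_vec[of _ n n])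
  qed
  have form: "v \<bullet> (T *\<^sub>v v) = \<mu> * (v \<bullet> v) - v \<bullet> (S *\<^sub>v v)" if v: "v \<in> carrier_vec n" for v
    using v S(1) by (simp add: Tv scalar_prod_minus_distrib[of _ n])
  have "det T = 0"
  proof (rule ccontr)
    assume "det T \<noteq> 0"
    then obtain R where R: "R \<in> carrier_mat n n" "R * T = 1\<^sub>m n"
      \<comment> \<open>The instantiated argument is only the extension slot of the record
        \<open>ring_mat\<close>.\<close>
      using det_non_zero_imp_unit[OF T, of undefined]
      by (auto simp: Units_def ring_mat_simps)
    obtain B where B: "B > 0"
      "\<And>v. v \<in> carrier_vec n \<Longrightarrow> (T *\<^sub>v v) \<bullet> (T *\<^sub>v v) \<le> B * (v \<bullet> (T *\<^sub>v v))"
      using psd_mult_vec_le[OF T T_sym] ray form by (metis diff_ge_0_iff_ge)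
    obtain D where D: "D > 0"
      "\<And>v. v \<in> carrier_vec n \<Longrightarrow> (R *\<^sub>v v) \<bullet> (R *\<^sub>v v) \<le> D * (v \<bullet> v)"
      using mult_mat_vec_bounded[OF R(1)] by blast
    \<comment> \<open>The gap comes from \<open>v = R (T v)\<close>: \<open>D\<close> controls
      \<open>R\<close>, and \<open>B\<close> controls \<open>T v\<close> by the form of
      \<open>T\<close>.\<close>
    have "\<mu> - 1 / (B * D) \<in> W"
      unfolding W_def
    proof (intro CollectI ballI)
      fix v :: "real vec" assume v: "v \<in> carrier_vec n"
      have "R *\<^sub>v (T *\<^sub>v v) = v"
        using assoc_mult_mat_vec[OF R(1) T v] R(2) v by simp
      then have "v \<bullet> v \<le> D * ((T *\<^sub>v v) \<bullet> (T *\<^sub>v v))"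
        using D(2)[of "T *\<^sub>v v"] T v by simp
      also have "\<dots> \<le> D * (B * (v \<bullet> (T *\<^sub>v v)))"
        using B(2)[OF v] D(1) by (intro mult_left_mono) auto
      also have "v \<bullet> (T *\<^sub>v v) = \<mu> * (v \<bullet> v) - v \<bullet> (S *\<^sub>v v)"
        by (rule form[OF v])
      finally show "v \<bullet> (S *\<^sub>v v) \<le> (\<mu> - 1 / (B * D)) * (v \<bullet> v)"
        using B(1) D(1) by (simp add: field_simps)
    qed
    then have "\<mu> \<le> \<mu> - 1 / (B * D)"
      unfolding \<mu>_def by (rule cInf_lower[OF _ W_bdd])
    then show False using B(1) D(1) by (simp add: field_simps)
  qed
  then obtain w where w: "w \<in> carrier_vec n" "w \<noteq> 0\<^sub>v n" "T *\<^sub>v w = 0\<^sub>v n"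
    using det_0_iff_vec_prod_zero_field[OF T] by blast
  have "S *\<^sub>v w = \<mu> \<cdot>\<^sub>v w"
  proof (rule eq_vecI)
    fix i assume "i < dim_vec (\<mu> \<cdot>\<^sub>v w)"
    then have i: "i < n" using w by simp
    have "(\<mu> \<cdot>\<^sub>v w - S *\<^sub>v w) $ i = 0\<^sub>v n $ i"
      using w Tv[OF w(1)] by simp
    then show "(S *\<^sub>v w) $ i = (\<mu> \<cdot>\<^sub>v w) $ i"
      using i w S(1) by simp
  qed (use w S in auto)
  then have "eigenvalue S \<mu>"
    using w S(1) unfolding eigenvalue_def eigenvector_def by auto
  then show thesis using ray that by blast
qed

text \<open>The maximum for \<open>- S\<close>, with the signs reversed.\<close>

lemma symmetric_rayleigh_min:
  fixes S :: "real mat"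
  assumes S: "S \<in> carrier_mat n n" "S\<^sup>T = S" and n: "n > 0"
  obtains \<mu> where "eigenvalue S \<mu>"
    and "\<And>v. v \<in> carrier_vec n \<Longrightarrow> \<mu> * (v \<bullet> v) \<le> v \<bullet> (S *\<^sub>v v)"
proof -
  have sym: "- S \<in> carrier_mat n n" "(- S)\<^sup>T = - S"
    using S by (auto simp: transpose_uminus)
  have neg: "(- S) *\<^sub>v v = - (S *\<^sub>v v)" if "v \<in> carrier_vec n" for v
    using that S by (intro eq_vecI) auto
  obtain \<mu> where \<mu>: "eigenvalue (- S) \<mu>"
    "\<And>v. v \<in> carrier_vec n \<Longrightarrow> v \<bullet> ((- S) *\<^sub>v v) \<le> \<mu> * (v \<bullet> v)"
    using symmetric_rayleigh_max[OF sym n] by blast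
  from \<mu>(1) obtain w where w: "w \<in> carrier_vec n" "w \<noteq> 0\<^sub>v n" "(- S) *\<^sub>v w = \<mu> \<cdot>\<^sub>v w"
    using S unfolding eigenvalue_def eigenvector_def by auto
  have "S *\<^sub>v w = - (- (S *\<^sub>v w))" by (rule eq_vecI) auto
  also have "\<dots> = - (\<mu> \<cdot>\<^sub>v w)" using w neg[OF w(1)] by simp
  also have "\<dots> = (- \<mu>) \<cdot>\<^sub>v w" by (rule eq_vecI) auto
  finally have "eigenvalue S (- \<mu>)"
    using w S unfolding eigenvalue_def eigenvector_def by auto
  moreover have "- \<mu> * (v \<bullet> v) \<le> v \<bullet> (S *\<^sub>v v)" if v: "v \<in> carrier_vec n" for v
    using \<mu>(2)[OF v] neg[OF v] v S by simp
  ultimately show thesis using that by blast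
qed

section \<open>Real spectrum of symmetric matrices\<close>

lemma proots_linear_factors: "proots (\<Prod>a\<leftarrow>as. [:- a, 1:]) = mset (as :: 'a :: idom list)"
proof -
  have "proots (\<Prod>a\<leftarrow>as. [:- a, 1:]) = sum_list (map proots (map (\<lambda>a. [:- a, 1:]) as))"
    by (subst proots_prod_list[symmetric]) auto
  also have "\<dots> = mset as" by (induction as) auto
  finally show ?thesis .
qed

text \<open>Factor over the complex numbers; symmetry forces every root to be real, and the
  factorization is pulled back along the injective embedding of the reals. This is what makes the
  list behind \<open>sing_val\<close> have full length.\<close>

lemma symmetric_char_poly_splits:
  fixes S :: "real mat"
  assumes S: "S \<in> carrier_mat n n" "S\<^sup>T = S"
  obtains es where "char_poly S = (\<Prod>a\<leftarrow>es. [:- a, 1:])" and "length es = n"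
proof -
  interpret map_poly_inj_idom_hom complex_of_real ..
  define A where "A = map_mat complex_of_real S"
  have A: "A \<in> carrier_mat n n" using S by (simp add: A_def)
  obtain as where as: "char_poly A = (\<Prod>a\<leftarrow>as. [:- a, 1:])" "length as = n"
    using char_poly_factorized[OF A] by blast
  have real: "complex_of_real (Re a) = a" if a: "a \<in> set as" for a
  proof -
    have "poly (char_poly A) a = 0"
      unfolding as(1) by (rule linear_poly_root[OF a])
    then obtain w where w: "w \<in> carrier_vec n" "w \<noteq> 0\<^sub>v n" "A *\<^sub>v w = a \<cdot>\<^sub>v w"
      using eigenvalue_root_char_poly[OF A] A unfolding eigenvalue_def eigenvector_def by auto
    have A_sym: "A\<^sup>T = A" using S(2) by (simp add: A_def map_mat_transpose)
    \<comment> \<open>\<open>A\<close> has real entries, so conjugating an eigenvector conjugates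
      the eigenvalue. Moving \<open>A\<close> across the product of \<open>w\<close> with its
      conjugate then compares \<open>a\<close> with \<open>cnj a\<close>.\<close>
    have "A *\<^sub>v conjugate w = conjugate (A *\<^sub>v w)"
      using w(1) S(1) by (intro eq_vecI) (auto simp: A_def scalar_prod_def)
    then have conj: "A *\<^sub>v conjugate w = cnj a \<cdot>\<^sub>v conjugate w"
      by (simp add: w(3) conjugate_smult_vec)
    have "a * (w \<bullet>c w) = (A *\<^sub>v w) \<bullet>c w"
      using w by simp
    also have "\<dots> = w \<bullet> (A *\<^sub>v conjugate w)"
      using transpose_vec_mult_scalar[of A n n "conjugate w" w] A A_sym w by simp
    also have "\<dots> = cnj a * (w \<bullet>c w)"
      using w by (simp add: conj)
    finally have "a = cnj a"
      using conjugate_square_eq_0_vec[OF w(1)] w(2) by simp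
    then show ?thesis by (metis Reals_cnj_iff of_real_Re)
  qed
  have "map_poly complex_of_real (char_poly S) = char_poly A"
    using of_real_hom.char_poly_hom[OF S(1), where ?'a = complex] by (simp add: A_def)
  also have "\<dots> = (\<Prod>a\<leftarrow>map (complex_of_real \<circ> Re) as. [:- a, 1:])"
    unfolding as(1) using real by (intro arg_cong[where f = prod_list] map_cong) (auto cong: map_cong)
  also have "\<dots> = map_poly complex_of_real (\<Prod>a\<leftarrow>map Re as. [:- a, 1:])"
    by (simp add: hom_prod_list o_def)
  finally have "char_poly S = (\<Prod>a\<leftarrow>map Re as. [:- a, 1:])"
    by (rule injectivity)
  then show thesis by (rule that) (simp add: as(2))
qed

section \<open>Singular values and the spectral norm\<close>

lemma gram_scalar_prod:
  fixes M :: "real mat"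
  assumes "M \<in> carrier_mat m n" "v \<in> carrier_vec n"
  shows "v \<bullet> ((M\<^sup>T * M) *\<^sub>v v) = (eucl_norm (M *\<^sub>v v))\<^sup>2"
proof -
  have "(M\<^sup>T * M) *\<^sub>v v = M\<^sup>T *\<^sub>v (M *\<^sub>v v)"
    using assms by (simp add: assoc_mult_mat_vec[of _ n m _ n])
  moreover have "v \<bullet> (M\<^sup>T *\<^sub>v (M *\<^sub>v v)) = (M *\<^sub>v v) \<bullet> (M *\<^sub>v v)"
    using transpose_vec_mult_scalar[of "M\<^sup>T" n m "M *\<^sub>v v" v] assms by simp
  ultimately show ?thesis by (simp add: eucl_norm_square)
qed

lemma gram_carrier: "M \<in> carrier_mat m n \<Longrightarrow> M\<^sup>T * M \<in> carrier_mat n n"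
  by (rule mult_carrier_mat[of _ _ m]) auto

lemma gram_symmetric:
  "(M :: real mat) \<in> carrier_mat m n \<Longrightarrow> (M\<^sup>T * M)\<^sup>T = M\<^sup>T * M"
  by (simp add: transpose_mult[of _ n m _ n])

text \<open>The only place where \<open>sing_val\<close> is unfolded; later facts rely on these four
  properties of the list. Its length is \<open>n\<close> because the characteristic polynomial of
  the Gram matrix splits over the reals.\<close>

lemma sing_val_list:
  assumes M: "M \<in> carrier_mat m n"
  obtains L where "length L = n" and "sorted (rev L)"
    and "set L = sqrt ` {e. eigenvalue (M\<^sup>T * M) e}" and "\<And>i. sing_val i M = L ! (i - 1)"
proof
  let ?S = "M\<^sup>T * M"
  define L where "L = rev (sorted_list_of_multiset (image_mset sqrt (proots (char_poly ?S))))"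
  note S = gram_carrier[OF M] gram_symmetric[OF M]
  obtain es where es: "char_poly ?S = (\<Prod>a\<leftarrow>es. [:- a, 1:])" "length es = n"
    using symmetric_char_poly_splits[OF S] by blast
  have mset_L: "mset L = image_mset sqrt (proots (char_poly ?S))"
    by (simp add: L_def)
  then have "length L = size (proots (char_poly ?S))"
    by (metis size_image_mset size_mset)
  then show "length L = n"
    by (simp add: es proots_linear_factors)
  show "sorted (rev L)"
    by (simp add: L_def)
  have "char_poly ?S \<noteq> 0"
    using degree_monic_char_poly[OF S(1)] by auto
  moreover have "set L = sqrt ` set_mset (proots (char_poly ?S))"
    using mset_L by (metis set_image_mset set_mset_mset)
  ultimately show "set L = sqrt ` {e. eigenvalue ?S e}"
    by (simp add: eigenvalue_root_char_poly[OF S(1)])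
  show "sing_val i M = L ! (i - 1)" for i
    by (simp add: sing_val_def L_def)
qed

lemma sing_val_antimono:
  assumes "M \<in> carrier_mat m n" "i \<le> j" "1 \<le> j" "j \<le> n"
  shows "sing_val j M \<le> sing_val i M"
proof -
  obtain L where L: "length L = n" "sorted (rev L)" "\<And>i. sing_val i M = L ! (i - 1)"
    using sing_val_list[OF assms(1)] by metis
  show ?thesis
    unfolding L(3) by (rule sorted_rev_nth_mono[OF L(2)]) (use assms L(1) in auto)
qed

text \<open>Normalize an eigenvector of the Gram matrix. Evaluating a uniform stretching bound at
  such a vector turns it into a bound on a singular value.\<close>

lemma sing_val_attained:
  assumes M: "M \<in> carrier_mat m n" and i: "1 \<le> i" "i \<le> n"
  obtains v where "v \<in> carrier_vec n" "eucl_norm v = 1" "eucl_norm (M *\<^sub>v v) = sing_val i M"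
proof -
  obtain L where L: "length L = n" "set L = sqrt ` {e. eigenvalue (M\<^sup>T * M) e}"
    "sing_val i M = L ! (i - 1)"
    using sing_val_list[OF M] by metis
  have "L ! (i - 1) \<in> set L" using i L(1) by simp
  then obtain e where e: "eigenvalue (M\<^sup>T * M) e" "sing_val i M = sqrt e"
    using L(2,3) by auto
  obtain w where w: "w \<in> carrier_vec n" "w \<noteq> 0\<^sub>v n" "(M\<^sup>T * M) *\<^sub>v w = e \<cdot>\<^sub>v w"
    using e(1) M unfolding eigenvalue_def eigenvector_def by auto
  have pos: "eucl_norm w > 0"
    using eucl_norm_eq_0[OF w(1)] w(2) eucl_norm_nonneg[of w] by linarith
  have "(eucl_norm (M *\<^sub>v w))\<^sup>2 = e * (eucl_norm w)\<^sup>2"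
    using gram_scalar_prod[OF M w(1)] w by (simp add: eucl_norm_square)
  \<comment> \<open>In HOL \<open>sqrt\<close> is multiplicative on all reals, so the sign of
    \<open>e\<close> needs no separate argument.\<close>
  then have "sqrt ((eucl_norm (M *\<^sub>v w))\<^sup>2) = sqrt (e * (eucl_norm w)\<^sup>2)" by simp
  then have norm_Mw: "eucl_norm (M *\<^sub>v w) = sqrt e * eucl_norm w"
    by (simp add: real_sqrt_mult)
  define v where "v = (1 / eucl_norm w) \<cdot>\<^sub>v w"
  show thesis
  proof
    show "v \<in> carrier_vec n" using w by (simp add: v_def)
    show "eucl_norm v = 1" using pos by (simp add: v_def eucl_norm_smult)
    have "M *\<^sub>v v = (1 / eucl_norm w) \<cdot>\<^sub>v (M *\<^sub>v w)"
      unfolding v_def by (rule mult_mat_vec[OF M w(1)])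
    then show "eucl_norm (M *\<^sub>v v) = sing_val i M"
      using pos by (simp add: eucl_norm_smult norm_Mw e(2))
  qed
qed

text \<open>The maximal Rayleigh quotient of the Gram matrix is an eigenvalue, so its root occurs in
  the decreasing list and is at most the head.\<close>

lemma eucl_norm_mult_le_sing_val:
  assumes M: "M \<in> carrier_mat m n" and v: "v \<in> carrier_vec n" and n: "n > 0"
  shows "eucl_norm (M *\<^sub>v v) \<le> sing_val 1 M * eucl_norm v"
proof -
  obtain \<mu> where \<mu>: "eigenvalue (M\<^sup>T * M) \<mu>"
    "\<And>v. v \<in> carrier_vec n \<Longrightarrow> v \<bullet> ((M\<^sup>T * M) *\<^sub>v v) \<le> \<mu> * (v \<bullet> v)"
    using symmetric_rayleigh_max[OF gram_carrier[OF M] gram_symmetric[OF M] n] by blast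
  obtain L where L: "length L = n" "sorted (rev L)"
    "set L = sqrt ` {e. eigenvalue (M\<^sup>T * M) e}" "sing_val 1 M = L ! 0"
    using sing_val_list[OF M] by (metis diff_self_eq_0)
  from \<mu>(1) L(3) have "sqrt \<mu> \<in> set L" by blast
  then obtain j where "j < n" "L ! j = sqrt \<mu>"
    using L(1) by (auto simp: in_set_conv_nth)
  then have le: "sqrt \<mu> \<le> sing_val 1 M"
    using L(1,2,4) sorted_rev_nth_mono[of L 0 j] by simp
  have "(eucl_norm (M *\<^sub>v v))\<^sup>2 \<le> \<mu> * (eucl_norm v)\<^sup>2"
    using \<mu>(2)[OF v] gram_scalar_prod[OF M v] by (simp add: eucl_norm_square)
  then have "sqrt ((eucl_norm (M *\<^sub>v v))\<^sup>2) \<le> sqrt (\<mu> * (eucl_norm v)\<^sup>2)"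
    by (rule real_sqrt_le_mono)
  then have "eucl_norm (M *\<^sub>v v) \<le> sqrt \<mu> * eucl_norm v"
    by (simp add: real_sqrt_mult)
  also have "\<dots> \<le> sing_val 1 M * eucl_norm v"
    by (rule mult_right_mono[OF le eucl_norm_nonneg])
  finally show ?thesis .
qed

text \<open>Dually, the minimal Rayleigh quotient is an eigenvalue, and its root is at least the
  last entry, at index \<open>n - 1\<close>.\<close>

lemma sing_val_le_eucl_norm_mult:
  assumes M: "M \<in> carrier_mat m n" and v: "v \<in> carrier_vec n" and n: "n > 0"
  shows "sing_val n M * eucl_norm v \<le> eucl_norm (M *\<^sub>v v)"
proof -
  obtain \<mu> where \<mu>: "eigenvalue (M\<^sup>T * M) \<mu>"
    "\<And>v. v \<in> carrier_vec n \<Longrightarrow> \<mu> * (v \<bullet> v) \<le> v \<bullet> ((M\<^sup>T * M) *\<^sub>v v)"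
    using symmetric_rayleigh_min[OF gram_carrier[OF M] gram_symmetric[OF M] n] by blast
  obtain L where L: "length L = n" "sorted (rev L)"
    "set L = sqrt ` {e. eigenvalue (M\<^sup>T * M) e}" "sing_val n M = L ! (n - 1)"
    using sing_val_list[OF M] by metis
  from \<mu>(1) L(3) have "sqrt \<mu> \<in> set L" by blast
  then obtain j where j: "j < n" "L ! j = sqrt \<mu>"
    using L(1) by (auto simp: in_set_conv_nth)
  then have le: "sing_val n M \<le> sqrt \<mu>"
    using L(1,2,4) sorted_rev_nth_mono[of L j "n - 1"] by simp
  have "\<mu> * (eucl_norm v)\<^sup>2 \<le> (eucl_norm (M *\<^sub>v v))\<^sup>2"
    using \<mu>(2)[OF v] gram_scalar_prod[OF M v] by (simp add: eucl_norm_square)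
  then have "sqrt (\<mu> * (eucl_norm v)\<^sup>2) \<le> sqrt ((eucl_norm (M *\<^sub>v v))\<^sup>2)"
    by (rule real_sqrt_le_mono)
  then have "sqrt \<mu> * eucl_norm v \<le> eucl_norm (M *\<^sub>v v)"
    by (simp add: real_sqrt_mult)
  then show ?thesis
    using mult_right_mono[OF le eucl_norm_nonneg[of v]] by linarith
qed

section \<open>The spectral norm as the least stretching bound\<close>

lemma spectral_norm_le:
  assumes M: "M \<in> carrier_mat m n" and c: "0 \<le> c"
    and le: "\<And>v. v \<in> carrier_vec n \<Longrightarrow> eucl_norm (M *\<^sub>v v) \<le> c * eucl_norm v"
  shows "spectral_norm M \<le> c"
  unfolding spectral_norm_def
proof (rule cSUP_least)
  have "0\<^sub>v n \<in> {v \<in> carrier_vec (dim_col M). eucl_norm v \<le> 1}"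
    using M by (simp add: eucl_norm_def)
  then show "{v \<in> carrier_vec (dim_col M). eucl_norm v \<le> 1} \<noteq> {}" by blast
next
  fix v assume "v \<in> {v \<in> carrier_vec (dim_col M). eucl_norm v \<le> 1}"
  then have v: "v \<in> carrier_vec n" "eucl_norm v \<le> 1" using M by auto
  show "eucl_norm (M *\<^sub>v v) \<le> c"
    using le[OF v(1)] mult_left_mono[OF v(2) c] by simp
qed

lemma eucl_norm_mult_le_spectral_norm:
  assumes M: "M \<in> carrier_mat m n" and v: "v \<in> carrier_vec n"
  shows "eucl_norm (M *\<^sub>v v) \<le> spectral_norm M * eucl_norm v"
proof (cases "eucl_norm v = 0")
  case True
  then have "M *\<^sub>v v = 0\<^sub>v m"
    using eucl_norm_eq_0[OF v] M by (intro eq_vecI) auto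
  then show ?thesis using True by (simp add: eucl_norm_def)
next
  case False
  then have pos: "eucl_norm v > 0" using eucl_norm_nonneg[of v] by linarith
  obtain C where C: "C > 0"
    "\<And>v. v \<in> carrier_vec n \<Longrightarrow> (M *\<^sub>v v) \<bullet> (M *\<^sub>v v) \<le> C * (v \<bullet> v)"
    using mult_mat_vec_bounded[OF M] by blast
  \<comment> \<open>A real supremum dominates its members only once the set is known to be
    bounded.\<close>
  have bdd: "bdd_above ((\<lambda>v. eucl_norm (M *\<^sub>v v)) ` {v \<in> carrier_vec (dim_col M). eucl_norm v \<le> 1})"
  proof (rule bdd_aboveI2)
    fix w assume "w \<in> {v \<in> carrier_vec (dim_col M). eucl_norm v \<le> 1}"
    then have w: "w \<in> carrier_vec n" "w \<bullet> w \<le> 1" using M by (auto simp: eucl_norm_def)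
    then have "C * (w \<bullet> w) \<le> C * 1" using C(1) by (intro mult_left_mono) auto
    with C(2)[OF w(1)] have "(M *\<^sub>v w) \<bullet> (M *\<^sub>v w) \<le> C" by linarith
    then show "eucl_norm (M *\<^sub>v w) \<le> sqrt C" by (simp add: eucl_norm_def)
  qed
  define w where "w = (1 / eucl_norm v) \<cdot>\<^sub>v v"
  have w: "w \<in> {v \<in> carrier_vec (dim_col M). eucl_norm v \<le> 1}"
    using M v pos by (simp add: w_def eucl_norm_smult)
  have "M *\<^sub>v w = (1 / eucl_norm v) \<cdot>\<^sub>v (M *\<^sub>v v)"
    unfolding w_def by (rule mult_mat_vec[OF M v])
  then have "eucl_norm (M *\<^sub>v v) / eucl_norm v = eucl_norm (M *\<^sub>v w)"
    using pos by (simp add: eucl_norm_smult)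
  also have "\<dots> \<le> spectral_norm M"
    unfolding spectral_norm_def by (rule cSUP_upper[OF w bdd])
  finally show ?thesis using pos by (simp add: field_simps)
qed

lemma spectral_norm_nonneg:
  assumes M: "M \<in> carrier_mat m n"
  shows "0 \<le> spectral_norm M"
proof (cases "n = 0")
  \<comment> \<open>Without columns there is no unit vector, but the unit ball still contains the
    empty vector, and the supremum is the norm of its image.\<close>
  case True
  then have "{v \<in> carrier_vec (dim_col M). eucl_norm v \<le> 1} = {0\<^sub>v 0}"
    using M by (auto simp: eucl_norm_def)
  then show ?thesis by (simp add: spectral_norm_def)
next
  case False
  then have "eucl_norm (unit_vec n 0 :: real vec) = 1"
    by (simp add: eucl_norm_def)
  then show ?thesis
    using eucl_norm_mult_le_spectral_norm[OF M, of "unit_vec n 0"]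
      order_trans[OF eucl_norm_nonneg] by simp
qed

lemma sing_val_1_le:
  assumes M: "M \<in> carrier_mat m n" and n: "n > 0"
    and le: "\<And>v. v \<in> carrier_vec n \<Longrightarrow> eucl_norm (M *\<^sub>v v) \<le> c * eucl_norm v"
  shows "sing_val 1 M \<le> c"
proof -
  obtain v where "v \<in> carrier_vec n" "eucl_norm v = 1" "eucl_norm (M *\<^sub>v v) = sing_val 1 M"
    by (rule sing_val_attained[OF M, of 1]) (use n in auto)
  with le[of v] show ?thesis by simp
qed

lemma sing_val_last_ge:
  assumes M: "M \<in> carrier_mat m n" and n: "n > 0"
    and le: "\<And>v. v \<in> carrier_vec n \<Longrightarrow> c * eucl_norm v \<le> eucl_norm (M *\<^sub>v v)"
  shows "c \<le> sing_val n M"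
proof -
  obtain v where "v \<in> carrier_vec n" "eucl_norm v = 1" "eucl_norm (M *\<^sub>v v) = sing_val n M"
    by (rule sing_val_attained[OF M, of n]) (use n in auto)
  with le[of v] show ?thesis by simp
qed

section \<open>The pseudoinverse\<close>

text \<open>Penrose's argument: \<open>M * X\<close> equals \<open>(M * Y) * (M * X)\<close>, which
  by symmetry is the transpose of \<open>(M * X) * (M * Y)\<close>, that is, \<open>M * Y\<close>;
  likewise \<open>X * M = Y * M\<close>. It gives the definite description in \<open>pinv\<close>
  its meaning.\<close>

lemma is_pinv_unique:
  assumes M: "M \<in> carrier_mat m n" and X: "is_pinv M X" and Y: "is_pinv M Y"
  shows "X = Y"
proof -
  have carr: "X \<in> carrier_mat n m" "Y \<in> carrier_mat n m" using M X Y by (auto simp: is_pinv_def)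
  note assoc = assoc_mult_mat[of _ n m _ n _ m] assoc_mult_mat[of _ m n _ m _ m]
    assoc_mult_mat[of _ n m _ n _ n] assoc_mult_mat[of _ m n _ m _ n]
    assoc_mult_mat[of _ m n _ n _ m] assoc_mult_mat[of _ n m _ m _ n]
  have MX_carr: "M * X \<in> carrier_mat m m" "M * Y \<in> carrier_mat m m"
    "X * M \<in> carrier_mat n n" "Y * M \<in> carrier_mat n n"
    using M carr by auto
  have "M * X = (M * Y * M) * X" using Y by (simp add: is_pinv_def)
  also have "\<dots> = (M * Y) * (M * X)"
    using M carr by (simp add: assoc)
  also have "\<dots> = ((M * X) * (M * Y))\<^sup>T"
    using transpose_mult[OF MX_carr(1,2)] X Y by (simp add: is_pinv_def)
  also have "(M * X) * (M * Y) = (M * X * M) * Y"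
    using M carr by (simp add: assoc)
  also have "(M * X * M * Y)\<^sup>T = M * Y" using X Y by (simp add: is_pinv_def)
  finally have MX: "M * X = M * Y" .
  have "X * M = X * (M * Y * M)" using Y by (simp add: is_pinv_def)
  also have "\<dots> = (X * M) * (Y * M)"
    using M carr by (simp add: assoc)
  also have "\<dots> = ((Y * M) * (X * M))\<^sup>T"
    using transpose_mult[OF MX_carr(4,3)] X Y by (simp add: is_pinv_def)
  also have "(Y * M) * (X * M) = Y * (M * X * M)"
    using M carr by (simp add: assoc)
  also have "(Y * (M * X * M))\<^sup>T = Y * M" using X Y by (simp add: is_pinv_def)
  finally have XM: "X * M = Y * M" .
  have "X = X * M * X" using X by (simp add: is_pinv_def)
  also have "\<dots> = Y * (M * X)"
    using M carr by (simp add: XM assoc_mult_mat[of _ n m _ n _ m])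
  also have "\<dots> = Y * M * Y"
    using M carr by (simp add: MX assoc_mult_mat[of _ n m _ n _ m])
  also have "\<dots> = Y" using Y by (simp add: is_pinv_def)
  finally show ?thesis .
qed

lemma pinv_eqI:
  assumes "M \<in> carrier_mat m n" "is_pinv M X"
  shows "pinv M = X"
  unfolding pinv_def using assms is_pinv_unique by (blast intro: the_equality)

text \<open>The pseudoinverse is the inverse of the Gram matrix times \<open>M\<^sup>T\<close>. The
  Gram matrix is invertible since a vector in its kernel has an image under \<open>M\<close> of norm
  zero.\<close>

lemma is_pinv_full_col_rank:
  assumes M: "M \<in> carrier_mat m n"
    and inj: "\<And>v. v \<in> carrier_vec n \<Longrightarrow> M *\<^sub>v v = 0\<^sub>v m \<Longrightarrow> v = 0\<^sub>v n"
  shows "is_pinv M (pinv M)" and "pinv M * M = 1\<^sub>m n"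
proof -
  let ?S = "M\<^sup>T * M"
  note S = gram_carrier[OF M] gram_symmetric[OF M]
  have "det ?S \<noteq> 0"
  proof
    assume "det ?S = 0"
    then obtain v where v: "v \<in> carrier_vec n" "v \<noteq> 0\<^sub>v n" "?S *\<^sub>v v = 0\<^sub>v n"
      using det_0_iff_vec_prod_zero_field[OF S(1)] by blast
    then have "eucl_norm (M *\<^sub>v v) = 0"
      using gram_scalar_prod[OF M v(1)] by simp
    then have "M *\<^sub>v v = 0\<^sub>v m"
      using eucl_norm_eq_0[of "M *\<^sub>v v" m] M v by simp
    with inj v show False by blast
  qed
  then obtain R where R: "R \<in> carrier_mat n n" "R * ?S = 1\<^sub>m n" "?S * R = 1\<^sub>m n"
    using det_non_zero_imp_unit[OF S(1), of undefined] by (auto simp: Units_def ring_mat_simps)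
  \<comment> \<open>Symmetry of \<open>R\<close> makes \<open>M * X\<close> symmetric; the other
    Penrose conditions follow from \<open>X * M\<close> being the identity.\<close>
  have R_sym: "R\<^sup>T = R"
  proof -
    have "R\<^sup>T * ?S = (?S * R)\<^sup>T"
      unfolding transpose_mult[OF S(1) R(1)] S(2) ..
    then have RS: "R\<^sup>T * ?S = 1\<^sub>m n" unfolding R(3) by simp
    have "R\<^sup>T = R\<^sup>T * (?S * R)" using R by simp
    also have "\<dots> = (R\<^sup>T * ?S) * R"
      using S R by (intro assoc_mult_mat[symmetric, of _ n n _ n _ n]) auto
    finally show ?thesis using RS R by simp
  qed
  define X where "X = R * M\<^sup>T"
  have X: "X \<in> carrier_mat n m" using R M by (simp add: X_def)
  have XM: "X * M = 1\<^sub>m n"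
    unfolding X_def using R M by (simp add: assoc_mult_mat[of R n n "M\<^sup>T" m M n])
  have "(M * X)\<^sup>T = X\<^sup>T * M\<^sup>T" using M X by (simp add: transpose_mult[of _ m n _ m])
  also have "X\<^sup>T = M * R"
    unfolding X_def using M R by (simp add: transpose_mult[of _ n n _ m] R_sym)
  also have "M * R * M\<^sup>T = M * X"
    unfolding X_def using M R by (simp add: assoc_mult_mat[of _ m n _ n _ m])
  finally have "is_pinv M X"
    unfolding is_pinv_def using M X XM
    by (simp add: assoc_mult_mat[of _ m n _ m _ n])
  then show "is_pinv M (pinv M)" "pinv M * M = 1\<^sub>m n"
    using pinv_eqI[OF M] XM by auto
qed

lemma sing_val_last_pos_imp_inj:
  assumes M: "M \<in> carrier_mat m n" and n: "n > 0" and pos: "sing_val n M > 0"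
    and v: "v \<in> carrier_vec n" "M *\<^sub>v v = 0\<^sub>v m"
  shows "v = 0\<^sub>v n"
proof -
  have "sing_val n M * eucl_norm v \<le> 0"
    using sing_val_le_eucl_norm_mult[OF M v(1) n] v(2) by (simp add: eucl_norm_def)
  then have "eucl_norm v = 0"
    using pos eucl_norm_nonneg[of v] by (simp add: mult_le_0_iff)
  then show ?thesis using eucl_norm_eq_0[OF v(1)] by simp
qed

text \<open>\<open>M * pinv M\<close> is an orthogonal projection, so it does not lengthen
  \<open>y\<close>, while \<open>M\<close> stretches \<open>pinv M *\<^sub>v y\<close> by at least
  its smallest singular value.\<close>

lemma spectral_norm_pinv_le:
  assumes M: "M \<in> carrier_mat m n" and n: "n > 0" and pos: "sing_val n M > 0"
  shows "spectral_norm (pinv M) \<le> 1 / sing_val n M"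
proof -
  let ?X = "pinv M" and ?\<sigma> = "sing_val n M"
  have X: "is_pinv M ?X"
    by (rule is_pinv_full_col_rank(1)[OF M sing_val_last_pos_imp_inj[OF M n pos]])
  then have X_carr: "?X \<in> carrier_mat n m" using M by (simp add: is_pinv_def)
  show ?thesis
  proof (rule spectral_norm_le[OF X_carr])
    show "0 \<le> 1 / ?\<sigma>" using pos by simp
    fix y :: "real vec" assume y: "y \<in> carrier_vec m"
    define P where "P = M * ?X"
    have P: "P \<in> carrier_mat m m" "P\<^sup>T = P" using M X_carr X by (auto simp: P_def is_pinv_def)
    have "P * P = (M * ?X * M) * ?X"
      using M X_carr
      by (simp add: P_def assoc_mult_mat[of _ n m _ n _ m] assoc_mult_mat[of _ m n _ m _ m]
        assoc_mult_mat[of _ m n _ m _ n] assoc_mult_mat[of _ m n _ n _ m])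
    then have PP: "P * P = P" using X by (simp add: P_def is_pinv_def)
    define z where "z = P *\<^sub>v y"
    have z: "z \<in> carrier_vec m" using P y by (simp add: z_def)
    have "P *\<^sub>v z = z"
      using assoc_mult_mat_vec[OF P(1) P(1) y] by (simp add: z_def PP)
    then have "z \<bullet> z = z \<bullet> y"
      using symmetric_mat_scalar_prod[OF P z y] by (simp add: z_def)
    then have "z \<bullet> z \<le> y \<bullet> y"
      using scalar_prod_le_mean[OF z y] by simp
    then have z_le: "eucl_norm z \<le> eucl_norm y" by (simp add: eucl_norm_def)
    have "M *\<^sub>v (?X *\<^sub>v y) = z"
      using assoc_mult_mat_vec[OF M X_carr y] by (simp add: z_def P_def)
    then have "?\<sigma> * eucl_norm (?X *\<^sub>v y) \<le> eucl_norm z"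
      using sing_val_le_eucl_norm_mult[OF M, of "?X *\<^sub>v y"] X_carr y n by simp
    with z_le show "eucl_norm (?X *\<^sub>v y) \<le> 1 / ?\<sigma> * eucl_norm y"
      using pos by (simp add: field_simps)
  qed
qed

text \<open>Take norms in \<open>pinv M *\<^sub>v (M *\<^sub>v v) = v\<close>. Requiring this for a
  single \<open>v\<close> instead of injectivity covers \<open>A\<close>, which may be
  singular.\<close>

lemma spectral_norm_pinv_ge:
  assumes M: "M \<in> carrier_mat m n" and n: "n > 0"
    and X: "is_pinv M (pinv M)"
    and v: "v \<in> carrier_vec n" "pinv M *\<^sub>v (M *\<^sub>v v) = v" "eucl_norm v = 1"
  shows "1 \<le> spectral_norm (pinv M) * eucl_norm (M *\<^sub>v v)"
  using eucl_norm_mult_le_spectral_norm[of "pinv M" n m "M *\<^sub>v v"] assms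
  by (simp add: is_pinv_def)

section \<open>Compact singular value and Arnoldi decompositions\<close>

lemma orthonormal_cols_cancel:
  assumes "M \<in> carrier_mat m n" "orthonormal_cols M" "v \<in> carrier_vec n"
  shows "M\<^sup>T *\<^sub>v (M *\<^sub>v v) = v"
proof -
  have "M\<^sup>T *\<^sub>v (M *\<^sub>v v) = (M\<^sup>T * M) *\<^sub>v v"
    using assms by (simp add: assoc_mult_mat_vec[of _ n m _ n])
  also have "M\<^sup>T * M = 1\<^sub>m n"
    using assms by (simp add: orthonormal_cols_def)
  finally show ?thesis using assms by simp
qed

lemma orthonormal_cols_norm:
  assumes M: "M \<in> carrier_mat m n" "orthonormal_cols M" and v: "v \<in> carrier_vec n"
  shows "eucl_norm (M *\<^sub>v v) = eucl_norm v"
proof -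
  have "M\<^sup>T * M = 1\<^sub>m n" using M by (simp add: orthonormal_cols_def)
  with gram_scalar_prod[OF M(1) v] have "(eucl_norm (M *\<^sub>v v))\<^sup>2 = v \<bullet> (1\<^sub>m n *\<^sub>v v)" by simp
  also have "\<dots> = (eucl_norm v)\<^sup>2" using v by (simp add: eucl_norm_square)
  finally show ?thesis by (simp add: power2_eq_iff_nonneg)
qed

lemma mat_diag_mult_vec:
  "(y :: 'a :: semiring_1 vec) \<in> carrier_vec r \<Longrightarrow> mat_diag r f *\<^sub>v y = vec r (\<lambda>i. f i * y $ i)"
  by (rule eq_vecI) (auto simp: mat_diag_def scalar_prod_def if_distrib[of "\<lambda>x. x * _"] cong: if_cong)

lemma eucl_norm_mat_diag_ge:
  assumes c: "0 \<le> c" and f: "\<And>i. i < r \<Longrightarrow> c \<le> f i" and y: "y \<in> carrier_vec r"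
  shows "c * eucl_norm y \<le> eucl_norm (mat_diag r f *\<^sub>v y)"
proof (rule power2_le_imp_le)
  have "(c * eucl_norm y)\<^sup>2 = (\<Sum>i<r. c\<^sup>2 * (y $ i)\<^sup>2)"
    using y unfolding power_mult_distrib eucl_norm_square
    by (simp add: scalar_prod_def power2_eq_square lessThan_atLeast0 flip: sum_distrib_left)
  also have "\<dots> \<le> (\<Sum>i<r. (f i)\<^sup>2 * (y $ i)\<^sup>2)"
    using c f by (intro sum_mono mult_right_mono power_mono) auto
  also have "\<dots> = (eucl_norm (mat_diag r f *\<^sub>v y))\<^sup>2"
    using y unfolding eucl_norm_square
    by (simp add: mat_diag_mult_vec scalar_prod_def power2_eq_square lessThan_atLeast0 ac_simps)
  finally show "(c * eucl_norm y)\<^sup>2 \<le> (eucl_norm (mat_diag r f *\<^sub>v y))\<^sup>2" .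
qed simp

text \<open>The products with the candidate collapse to \<open>U * U\<^sup>T\<close> and
  \<open>V * V\<^sup>T\<close>, which are symmetric and fix the outer factors. This reaches matrices
  of deficient column rank.\<close>

lemma is_pinv_svd:
  assumes U: "U \<in> carrier_mat m r" "orthonormal_cols U"
    and V: "V \<in> carrier_mat n r" "orthonormal_cols V"
    and s: "\<And>i. i < r \<Longrightarrow> s i \<noteq> 0"
  shows "is_pinv (U * mat_diag r s * V\<^sup>T) (V * mat_diag r (\<lambda>i. 1 / s i) * U\<^sup>T)"
proof -
  define D D' where "D = mat_diag r s" and "D' = mat_diag r (\<lambda>i. 1 / s i)"
  have D: "D \<in> carrier_mat r r" "D' \<in> carrier_mat r r" by (simp_all add: D_def D'_def)
  have DD': "D * D' = 1\<^sub>m r" "D' * D = 1\<^sub>m r"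
    unfolding D_def D'_def mat_diag_diag using s by (auto simp: mat_diag_def intro!: eq_matI)
  \<comment> \<open>Stated for general factors, as it is used twice with \<open>U\<close> and
    \<open>V\<close> in exchanged roles.\<close>
  have cancel: "(B * E * F\<^sup>T) * (F * E' * C\<^sup>T) = B * C\<^sup>T"
    if "B \<in> carrier_mat b r" "C \<in> carrier_mat c r" "F \<in> carrier_mat f r" "orthonormal_cols F"
      "E \<in> carrier_mat r r" "E' \<in> carrier_mat r r" "E * E' = 1\<^sub>m r" for b c f B C F E E'
  proof -
    have "(B * E * F\<^sup>T) * (F * E' * C\<^sup>T) = (B * E) * ((F\<^sup>T * F) * (E' * C\<^sup>T))"
      using that by (simp add: assoc_mult_mat[of _ b r _ f _ c] assoc_mult_mat[of _ f r _ r _ c]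
          assoc_mult_mat[of _ r f _ r _ c] assoc_mult_mat[of _ b r _ r _ f]
          assoc_mult_mat[of _ b r _ r _ c] assoc_mult_mat[of _ r r _ f _ c])
    also have "\<dots> = (B * E) * (E' * C\<^sup>T)"
      using that by (simp add: orthonormal_cols_def)
    also have "\<dots> = B * ((E * E') * C\<^sup>T)"
      using that(1,2,5,6) by (simp add: assoc_mult_mat[of _ b r _ r _ c] assoc_mult_mat[of _ r r _ r _ c])
    finally show ?thesis using that by simp
  qed
  let ?M = "U * D * V\<^sup>T" and ?X = "V * D' * U\<^sup>T"
  have MX: "?M * ?X = U * U\<^sup>T"
    by (rule cancel) (use U V D DD' in auto)
  have XM: "?X * ?M = V * V\<^sup>T"
    by (rule cancel) (use U V D DD' in auto)
  have proj: "(B * B\<^sup>T) * (B * E * C\<^sup>T) = B * E * C\<^sup>T"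
    if "B \<in> carrier_mat b r" "orthonormal_cols B" "C \<in> carrier_mat c r"
      "E \<in> carrier_mat r r" for b c B C E
  proof -
    have "(B * B\<^sup>T) * (B * E * C\<^sup>T) = B * ((B\<^sup>T * B) * (E * C\<^sup>T))"
      using that by (simp add: assoc_mult_mat[of _ b r _ b _ c] assoc_mult_mat[of _ b r _ r _ c]
          assoc_mult_mat[of _ r b _ r _ c])
    also have "\<dots> = B * (E * C\<^sup>T)"
      using that by (simp add: orthonormal_cols_def)
    finally show ?thesis
      using that by (simp add: assoc_mult_mat[of _ b r _ r _ c])
  qed
  have sym: "(B * B\<^sup>T)\<^sup>T = B * B\<^sup>T" if "B \<in> carrier_mat b r" for b and B :: "real mat"
    using that by (simp add: transpose_mult[of _ b r _ b])
  have "?X \<in> carrier_mat (dim_col ?M) (dim_row ?M)"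
    using U V D by simp
  then show ?thesis
    unfolding is_pinv_def D_def[symmetric] D'_def[symmetric]
    unfolding MX XM by (simp add: proj[OF U V(1) D(1)] proj[OF V U(1) D(2)] sym[OF U(1)] sym[OF V(1)])
qed

text \<open>Normally the extended basis matrix is an isometry. After a breakdown \<open>Q\<close> is
  one, and dropping the zero last row of \<open>H\<close>, at index \<open>k\<close>, leaves the
  norm unchanged.\<close>

lemma arnoldi_eucl_norm:
  assumes A: "A \<in> carrier_mat n n" and arn: "arnoldi n A v k Q H" and w: "w \<in> carrier_vec k"
  shows "eucl_norm (H *\<^sub>v w) = eucl_norm (A *\<^sub>v (Q *\<^sub>v w))"
proof -
  have Q: "Q \<in> carrier_mat n k" "orthonormal_cols Q" and H: "H \<in> carrier_mat (k + 1) k"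
    using arn by (auto simp: arnoldi_def)
  have AQw: "A *\<^sub>v (Q *\<^sub>v w) = (A * Q) *\<^sub>v w"
    using A Q w by (simp add: assoc_mult_mat_vec[of _ n n _ k])
  define H' where "H' = mat k k (\<lambda>(i, j). H $$ (i, j))"
  have H': "H' \<in> carrier_mat k k" by (simp add: H'_def)
  from arn consider
    q where "orthonormal_cols (mat_of_cols n (cols Q @ [q]))"
      "A * Q = mat_of_cols n (cols Q @ [q]) * H"
    | "row H k = 0\<^sub>v k" "A * Q = Q * H'"
    unfolding arnoldi_def Let_def H'_def by blast
  then show ?thesis
  proof cases
    case 1
    have Q': "mat_of_cols n (cols Q @ [q]) \<in> carrier_mat n (k + 1)"
      using Q by (auto intro!: carrier_matI)
    have "A *\<^sub>v (Q *\<^sub>v w) = mat_of_cols n (cols Q @ [q]) *\<^sub>v (H *\<^sub>v w)"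
      unfolding AQw 1(2) by (rule assoc_mult_mat_vec[OF Q' H w])
    then show ?thesis
      using orthonormal_cols_norm[OF Q' 1(1), of "H *\<^sub>v w"] H w by simp
  next
    case 2
    have "A *\<^sub>v (Q *\<^sub>v w) = Q *\<^sub>v (H' *\<^sub>v w)"
      unfolding AQw 2(2) by (rule assoc_mult_mat_vec[OF Q(1) H' w])
    then have "eucl_norm (A *\<^sub>v (Q *\<^sub>v w)) = eucl_norm (H' *\<^sub>v w)"
      using orthonormal_cols_norm[OF Q, of "H' *\<^sub>v w"] H' w by simp
    moreover have "(H *\<^sub>v w) $ i = (H' *\<^sub>v w) $ i" if "i < k" for i
      using that H w by (auto simp: H'_def scalar_prod_def)
    moreover have "(H *\<^sub>v w) $ k = 0"
      using H w 2(1) by simp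
    ultimately show ?thesis
      using H H' by (simp add: eucl_norm_def scalar_prod_def)
  qed
qed

section \<open>Krylov spaces inside the range\<close>

lemma col_space_iff:
  assumes "A \<in> carrier_mat n m"
  shows "y \<in> vec_space.col_space n A \<longleftrightarrow> (\<exists>x \<in> carrier_vec m. y = A *\<^sub>v x)"
  using assms unfolding vec_space.col_space_eq[OF assms] by auto

lemma pow_mat_mult_in_col_space:
  assumes A: "A \<in> carrier_mat n n" and v: "v \<in> vec_space.col_space n A"
  shows "(A ^\<^sub>m j) *\<^sub>v v \<in> vec_space.col_space n A"
  using v
\<comment> \<open>The power unfolds with the new factor on the right, so the induction hypothesis is
  applied to \<open>A *\<^sub>v v\<close>.\<close>
proof (induction j arbitrary: v)
  case 0
  then show ?case using A by (auto simp: col_space_iff)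
next
  case (Suc j)
  have v: "v \<in> carrier_vec n" using Suc.prems A by (auto simp: col_space_iff)
  then have "A *\<^sub>v v \<in> vec_space.col_space n A" using A by (auto simp: col_space_iff)
  then have "(A ^\<^sub>m j) *\<^sub>v (A *\<^sub>v v) \<in> vec_space.col_space n A" by (rule Suc.IH)
  then show ?case using A v by (simp add: assoc_mult_mat_vec[of _ n n _ n])
qed

lemma krylov_subset_col_space:
  assumes A: "A \<in> carrier_mat n n" and v: "v \<in> vec_space.col_space n A"
  shows "krylov n A v k \<subseteq> vec_space.col_space n A"
  unfolding krylov_def lin_span_def vec_space.col_space_def
proof (rule idom_vec.span_subsetI)
  show "set (cols A) \<subseteq> carrier_vec n" using A cols_dim by blast
  show "(\<lambda>j. (A ^\<^sub>m j) *\<^sub>v v) ` {..<k}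
      \<subseteq> LinearCombinations.module.span class_ring (module_vec TYPE(real) n) (set (cols A))"
    using pow_mat_mult_in_col_space[OF A v] by (auto simp: vec_space.col_space_def)
qed

text \<open>The case \<open>i = k\<close> of the span condition in \<open>arnoldi\<close> places the
  column in a Krylov space.\<close>

lemma arnoldi_col_in_col_space:
  assumes A: "A \<in> carrier_mat n n" and v: "v \<in> vec_space.col_space n A"
    and arn: "arnoldi n A v k Q H" and j: "j < k"
  shows "col Q j \<in> vec_space.col_space n A"
proof -
  interpret V: vec_space "TYPE(real)" n .
  have "Q \<in> carrier_mat n k" using arn by (simp add: arnoldi_def)
  then have "col Q ` {..<k} \<subseteq> carrier_vec n" by auto
  from V.in_own_span[OF this] j have "col Q j \<in> lin_span n (col Q ` {..<k})"
    by (auto simp: lin_span_def)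
  also have "\<dots> = krylov n A v k" using arn by (simp add: arnoldi_def)
  finally show ?thesis using krylov_subset_col_space[OF A v] by blast
qed

section \<open>Bounds for the extended Hessenberg matrix\<close>

theorem mainTheorem2:
  fixes n r k :: nat and A U1 V1 Q H :: "real mat" and b x0 r0 :: "real vec"
  assumes "A \<in> carrier_mat n n"
    and "A \<noteq> 0\<^sub>m n n"
    and "vec_space.rank n A = r"
    and "mat_kernel A \<inter> vec_space.col_space n A = {0\<^sub>v n}"
    and "is_compact_svd n r A U1 V1"
    and "b \<in> vec_space.col_space n A"
    and "x0 \<in> carrier_vec n"
    and "r0 = b - A *\<^sub>v x0"
    and "k \<ge> 1"
    and "subspace_dim n (krylov n A r0 k) = k"
    and "arnoldi n A r0 k Q H"
  shows "sing_val 1 H \<le> spectral_norm A * spectral_norm (V1\<^sup>T * U1)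
       \<and> sing_val k H \<ge> sing_val r A * sing_val r (V1\<^sup>T * U1)
       \<and> cond_num H \<le> cond_num A * cond_num (V1\<^sup>T * U1)"
proof -
  note A = assms(1) and arn = assms(11)
  define s where "s i = sing_val (i + 1) A" for i
  define D where "D = mat_diag r s"
  define P where "P = V1\<^sup>T * U1"
  have U: "U1 \<in> carrier_mat n r" "orthonormal_cols U1"
    and V: "V1 \<in> carrier_mat n r" "orthonormal_cols V1"
    and svd: "A = U1 * D * V1\<^sup>T" and sr: "sing_val r A > 0"
    using assms(5) by (auto simp: is_compact_svd_def D_def s_def[abs_def])
  have D: "D \<in> carrier_mat r r" by (simp add: D_def)
  have P: "P \<in> carrier_mat r r" using U V by (simp add: P_def)
  have r: "r > 0"
  proof (rule ccontr)
    assume "\<not> r > 0"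
    then have "A = 0\<^sub>m n n"
      unfolding svd using U V by (intro eq_matI) (auto simp: scalar_prod_def)
    with assms(2) show False by contradiction
  qed
  have "r \<le> n" using vec_space.rank_le_nc[OF A] assms(3) by simp
  \<comment> \<open>\<open>s\<close> is indexed from 0, so the smallest diagonal entry is
    \<open>s (r - 1)\<close>.\<close>
  then have s_ge: "sing_val r A \<le> s i" if "i < r" for i
    using that unfolding s_def by (intro sing_val_antimono[OF A]) auto
  with sr have s_pos: "s i > 0" if "i < r" for i using that by (meson less_le_trans)
  then have s_ne: "s i \<noteq> 0" if "i < r" for i using that by (metis less_irrefl)

  have A_vec: "A *\<^sub>v x = U1 *\<^sub>v (D *\<^sub>v (V1\<^sup>T *\<^sub>v x))" if "x \<in> carrier_vec n" for x
    unfolding svd using U V D that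
    by (simp add: assoc_mult_mat_vec[of _ n r _ n] assoc_mult_mat_vec[of _ n r _ r])
  have P_vec: "P *\<^sub>v y = V1\<^sup>T *\<^sub>v (U1 *\<^sub>v y)" if "y \<in> carrier_vec r" for y
    unfolding P_def using U V that by (simp add: assoc_mult_mat_vec[of _ r n _ r])
  have AV: "A *\<^sub>v (V1 *\<^sub>v y) = U1 *\<^sub>v (D *\<^sub>v y)" if "y \<in> carrier_vec r" for y
    using that V by (simp add: A_vec orthonormal_cols_cancel)
  \<comment> \<open>\<open>A\<close> sees only the component of a vector in the row space, and
    \<open>P *\<^sub>v y\<close> holds the coordinates of that component of
    \<open>U1 *\<^sub>v y\<close>.\<close>
  have AU: "A *\<^sub>v (U1 *\<^sub>v y) = A *\<^sub>v (V1 *\<^sub>v (P *\<^sub>v y))" if "y \<in> carrier_vec r" for y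
    using that U P by (simp add: A_vec[of "U1 *\<^sub>v y"] AV P_vec[symmetric])
  \<comment> \<open>\<open>U1 * U1\<^sup>T\<close> projects orthogonally onto the range of
    \<open>A\<close>.\<close>
  have UU: "U1 *\<^sub>v (U1\<^sup>T *\<^sub>v z) = z" if "z \<in> vec_space.col_space n A" for z
  proof -
    obtain x where x: "x \<in> carrier_vec n" "z = A *\<^sub>v x" using \<open>z \<in> _\<close> A by (auto simp: col_space_iff)
    then have "D *\<^sub>v (V1\<^sup>T *\<^sub>v x) \<in> carrier_vec r" using D V by simp
    then show ?thesis using U by (simp add: x(2) A_vec[OF x(1)] orthonormal_cols_cancel)
  qed

  have P_inj: "y = 0\<^sub>v r" if y: "y \<in> carrier_vec r" "P *\<^sub>v y = 0\<^sub>v r" for y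
  proof -
    \<comment> \<open>\<open>t\<close> solves \<open>D *\<^sub>v t = y\<close>, so that
      \<open>V1 *\<^sub>v t\<close> is a preimage of \<open>U1 *\<^sub>v y\<close> under
      \<open>A\<close>. As \<open>P *\<^sub>v y\<close> vanishes, \<open>U1 *\<^sub>v y\<close> also
      lies in the kernel.\<close>
    define t where "t = vec r (\<lambda>i. y $ i / s i)"
    have t: "t \<in> carrier_vec r" by (simp add: t_def)
    have "D *\<^sub>v t = vec r (\<lambda>i. s i * t $ i)"
      unfolding D_def by (rule mat_diag_mult_vec[OF t])
    also have "\<dots> = y"
      using y s_ne by (intro eq_vecI) (auto simp: t_def)
    finally have "U1 *\<^sub>v y = A *\<^sub>v (V1 *\<^sub>v t)" by (simp add: AV[OF t])
    then have "U1 *\<^sub>v y \<in> vec_space.col_space n A" using A V t by (auto simp: col_space_iff)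
    moreover have "A *\<^sub>v (U1 *\<^sub>v y) = 0\<^sub>v n"
      unfolding AU[OF y(1)] y(2) using A V by (intro eq_vecI) (auto simp: scalar_prod_def)
    then have "U1 *\<^sub>v y \<in> mat_kernel A" using A U y by (simp add: mat_kernel_def)
    ultimately have "U1 *\<^sub>v y = 0\<^sub>v n" using assms(4) by blast
    then have "eucl_norm y = 0"
      using orthonormal_cols_norm[OF U y(1)] by (simp add: eucl_norm_def)
    then show ?thesis using eucl_norm_eq_0[OF y(1)] by simp
  qed

  have r0: "r0 \<in> vec_space.col_space n A"
  proof -
    obtain xb where xb: "xb \<in> carrier_vec n" "b = A *\<^sub>v xb"
      using assms(6) A by (auto simp: col_space_iff)
    then have "r0 = A *\<^sub>v (xb - x0)"
      using A assms(7,8) by (simp add: mult_minus_distrib_mat_vec[of _ n n])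
    then show ?thesis using xb assms(7) A by (auto simp: col_space_iff)
  qed
  have Q: "Q \<in> carrier_mat n k" "orthonormal_cols Q" and H: "H \<in> carrier_mat (k + 1) k"
    using arn by (auto simp: arnoldi_def)
  have k: "k > 0" using assms(9) by simp
  have UUQ: "U1 * (U1\<^sup>T * Q) = Q"
  proof (rule mat_col_eqI)
    fix j assume "j < dim_col Q"
    then have j: "j < k" using Q by simp
    have UT: "U1\<^sup>T \<in> carrier_mat r n" using U by simp
    have "col (U1 * (U1\<^sup>T * Q)) j = U1 *\<^sub>v (U1\<^sup>T *\<^sub>v col Q j)"
      unfolding col_mult2[OF U(1) mult_carrier_mat[OF UT Q(1)] j] col_mult2[OF UT Q(1) j] ..
    also have "\<dots> = col Q j"
      by (rule UU[OF arnoldi_col_in_col_space[OF A r0 arn j]])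
    finally show "col (U1 * (U1\<^sup>T * Q)) j = col Q j" .
  qed (use U Q in auto)

  have H_bounds: "eucl_norm (H *\<^sub>v w) \<le> spectral_norm A * spectral_norm P * eucl_norm w
      \<and> sing_val r A * sing_val r P * eucl_norm w \<le> eucl_norm (H *\<^sub>v w)"
    if w: "w \<in> carrier_vec k" for w
  proof -
    \<comment> \<open>The coordinates of \<open>Q *\<^sub>v w\<close> in the basis \<open>U1\<close>
      of the range; both bases are orthonormal, so the norm is kept.\<close>
    define y where "y = (U1\<^sup>T * Q) *\<^sub>v w"
    have y: "y \<in> carrier_vec r" using U Q w by (simp add: y_def)
    have Py: "P *\<^sub>v y \<in> carrier_vec r" using P y by simp
    have "Q *\<^sub>v w = (U1 * (U1\<^sup>T * Q)) *\<^sub>v w" by (simp only: UUQ)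
    also have "\<dots> = U1 *\<^sub>v y"
      unfolding y_def using U Q w by (intro assoc_mult_mat_vec[of _ n r _ k]) auto
    finally have Qw: "Q *\<^sub>v w = U1 *\<^sub>v y" .
    have norm_y: "eucl_norm y = eucl_norm w"
      using orthonormal_cols_norm[OF U y] orthonormal_cols_norm[OF Q w] by (simp add: Qw)
    have Hw: "eucl_norm (H *\<^sub>v w) = eucl_norm (A *\<^sub>v (V1 *\<^sub>v (P *\<^sub>v y)))"
      using arnoldi_eucl_norm[OF A arn w] by (simp add: Qw AU[OF y])
    have "eucl_norm (H *\<^sub>v w) \<le> spectral_norm A * eucl_norm (P *\<^sub>v y)"
      using eucl_norm_mult_le_spectral_norm[OF A, of "V1 *\<^sub>v (P *\<^sub>v y)"] V Py
      by (simp add: Hw orthonormal_cols_norm[OF V Py])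
    also have "\<dots> \<le> spectral_norm A * (spectral_norm P * eucl_norm y)"
      by (intro mult_left_mono eucl_norm_mult_le_spectral_norm[OF P y] spectral_norm_nonneg[OF A])
    finally have upper: "eucl_norm (H *\<^sub>v w) \<le> spectral_norm A * spectral_norm P * eucl_norm w"
      by (simp add: norm_y)
    have "sing_val r A * (sing_val r P * eucl_norm y) \<le> sing_val r A * eucl_norm (P *\<^sub>v y)"
      using sr by (intro mult_left_mono sing_val_le_eucl_norm_mult[OF P y r]) simp
    also have "\<dots> \<le> eucl_norm (D *\<^sub>v (P *\<^sub>v y))"
      unfolding D_def by (rule eucl_norm_mat_diag_ge) (use sr s_ge Py in auto)
    also have "\<dots> = eucl_norm (H *\<^sub>v w)"
      using orthonormal_cols_norm[OF U, of "D *\<^sub>v (P *\<^sub>v y)"] D Py by (simp add: Hw AV[OF Py])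
    finally show ?thesis using upper by (simp add: norm_y)
  qed

  have upper: "sing_val 1 H \<le> spectral_norm A * spectral_norm P"
    by (rule sing_val_1_le[OF H k]) (use H_bounds in blast)
  have lower: "sing_val r A * sing_val r P \<le> sing_val k H"
    by (rule sing_val_last_ge[OF H k]) (use H_bounds in blast)

  \<comment> \<open>At a vector of least stretching, the lower bound on the norm of
    \<open>pinv P\<close> involves exactly \<open>sing_val r P\<close>, and also shows that this
    value is nonzero.\<close>
  obtain p where p: "p \<in> carrier_vec r" "eucl_norm p = 1" "eucl_norm (P *\<^sub>v p) = sing_val r P"
    by (rule sing_val_attained[OF P, of r]) (use r in auto)
  note P_pinv = is_pinv_full_col_rank[OF P P_inj]
  have P_pinv_carr: "pinv P \<in> carrier_mat r r"
    using P_pinv(1) P by (simp add: is_pinv_def)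
  have "pinv P *\<^sub>v (P *\<^sub>v p) = p"
    using assoc_mult_mat_vec[OF P_pinv_carr P p(1)] P_pinv(2) p(1) by simp
  then have P_ge: "1 \<le> spectral_norm (pinv P) * sing_val r P"
    using spectral_norm_pinv_ge[OF P r P_pinv(1) p(1) _ p(2)] p(3) by simp
  have \<sigma>P: "sing_val r P > 0"
  proof -
    have "sing_val r P \<noteq> 0" using P_ge by auto
    moreover have "sing_val r P \<ge> 0" using p(3) eucl_norm_nonneg[of "P *\<^sub>v p"] by simp
    ultimately show ?thesis by simp
  qed

  have A_ge: "1 \<le> spectral_norm (pinv A) * sing_val r A"
  proof -
    define D' where "D' = mat_diag r (\<lambda>i. 1 / s i)"
    define X where "X = V1 * D' * U1\<^sup>T"
    have D': "D' \<in> carrier_mat r r" by (simp add: D'_def)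
    have X: "is_pinv A X"
      unfolding svd X_def D_def D'_def using s_ne by (rule is_pinv_svd[OF U V])
    then have X_eq: "pinv A = X" by (rule pinv_eqI[OF A])
    \<comment> \<open>The last unit vector, so that \<open>V1 *\<^sub>v e\<close> is the right
      singular vector belonging to \<open>sing_val r A\<close>.\<close>
    define e where "e = (unit_vec r (r - 1) :: real vec)"
    have e: "e \<in> carrier_vec r" "eucl_norm e = 1" using r by (auto simp: e_def eucl_norm_def)
    have "D *\<^sub>v e = vec r (\<lambda>i. s i * e $ i)"
      unfolding D_def by (rule mat_diag_mult_vec[OF e(1)])
    also have "\<dots> = sing_val r A \<cdot>\<^sub>v e"
      using r by (intro eq_vecI) (auto simp: s_def e_def)
    finally have De: "D *\<^sub>v e = sing_val r A \<cdot>\<^sub>v e" .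
    have "D' *\<^sub>v (D *\<^sub>v e) = vec r (\<lambda>i. 1 / s i * (sing_val r A \<cdot>\<^sub>v e) $ i)"
      unfolding D'_def De using e(1) by (intro mat_diag_mult_vec) simp
    also have "\<dots> = e"
      using r sr by (intro eq_vecI) (auto simp: s_def e_def)
    finally have D'De: "D' *\<^sub>v (D *\<^sub>v e) = e" .
    have "X *\<^sub>v (A *\<^sub>v (V1 *\<^sub>v e)) = V1 *\<^sub>v (D' *\<^sub>v (U1\<^sup>T *\<^sub>v (U1 *\<^sub>v (D *\<^sub>v e))))"
      unfolding AV[OF e(1)] X_def using U V D D' e
      by (simp add: assoc_mult_mat_vec[of _ n r _ n] assoc_mult_mat_vec[of _ n r _ r])
    also have "\<dots> = V1 *\<^sub>v e"
      using U D e by (simp add: orthonormal_cols_cancel D'De)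
    finally have XAv: "pinv A *\<^sub>v (A *\<^sub>v (V1 *\<^sub>v e)) = V1 *\<^sub>v e" by (simp add: X_eq)
    have "eucl_norm (A *\<^sub>v (V1 *\<^sub>v e)) = sing_val r A"
      using orthonormal_cols_norm[OF U, of "D *\<^sub>v e"] D e sr
      by (simp add: AV De eucl_norm_smult)
    moreover have "1 \<le> spectral_norm (pinv A) * eucl_norm (A *\<^sub>v (V1 *\<^sub>v e))"
      by (rule spectral_norm_pinv_ge[OF A _ _ _ XAv])
        (use X X_eq r \<open>r \<le> n\<close> V e orthonormal_cols_norm[OF V e(1)] in auto)
    ultimately show ?thesis by simp
  qed

  have \<sigma>: "0 < sing_val r A * sing_val r P" using sr \<sigma>P by simp
  have H_norm: "spectral_norm H \<le> spectral_norm A * spectral_norm P"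
    by (rule spectral_norm_le[OF H])
      (use H_bounds in \<open>auto simp: spectral_norm_nonneg[OF A] spectral_norm_nonneg[OF P]\<close>)
  have "spectral_norm (pinv H) \<le> 1 / sing_val k H"
    using lower \<sigma> by (intro spectral_norm_pinv_le[OF H k]) linarith
  also have "\<dots> \<le> 1 / (sing_val r A * sing_val r P)"
    using lower \<sigma> by (intro divide_left_mono) auto
  \<comment> \<open>Multiply \<open>A_ge\<close> by \<open>P_ge\<close> and divide by the product of
    the singular values.\<close>
  also have "\<dots> \<le> spectral_norm (pinv A) * spectral_norm (pinv P)"
    using mult_mono[OF A_ge P_ge] \<sigma> A_ge by (simp add: divide_le_eq ac_simps)
  finally have H_pinv: "spectral_norm (pinv H) \<le> spectral_norm (pinv A) * spectral_norm (pinv P)" .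
  \<comment> \<open>\<open>pinv\<close> is a definite description, so the dimensions of
    \<open>pinv H\<close>, and with them the sign of its norm, are known only once a pseudoinverse
    is shown to exist.\<close>
  have "sing_val k H > 0" using lower \<sigma> by linarith
  then have "is_pinv H (pinv H)"
    by (rule is_pinv_full_col_rank(1)[OF H sing_val_last_pos_imp_inj[OF H k]])
  then have pinv_H: "pinv H \<in> carrier_mat k (k + 1)"
    using H by (simp add: is_pinv_def)
  have "cond_num H \<le> (spectral_norm A * spectral_norm P) * (spectral_norm (pinv A) * spectral_norm (pinv P))"
    unfolding cond_num_def
    by (intro mult_mono H_norm H_pinv mult_nonneg_nonneg spectral_norm_nonneg[OF A]
        spectral_norm_nonneg[OF P] spectral_norm_nonneg[OF pinv_H])
  then have "cond_num H \<le> cond_num A * cond_num P"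
    by (simp add: cond_num_def ac_simps)
  with upper lower show ?thesis by (simp add: P_def)
qed

end
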